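(* Suppose that the countable Markov shift $(\Sigma,\sigma)$ does not satisfy the $\mathcal{F}$-property. Then there exists a sequence of periodic measures on $\Sigma$ that converges on cylinders to some $F\in L(\Sigma)$, where $F$ cannot be extended to a measure.
   Context: Let $\mathbb{N}=\{1,2,\dots\}$ and let $B=(B(i,j))_{i,j\in\mathbb{N}}$ be a matrix with entries in $\{0,1\}$ having no zero row and no zero column. The (one-sided) countable Markov shift defined by $B$ is $\Sigma=\{(x_n)_{n\in\mathbb{N}}\in\mathbb{N}^{\mathbb{N}}: B(x_n,x_{n+1})=1 \text{ for all } n\}$ with the shift map $\sigma(x_1,x_2,\dots)=(x_2,x_3,\dots)$. A cylinder of length $n$ is $[a_1\dots a_n]=\{x\in\Sigma: x_j=a_j,\ 1\le j\le n\}$; $\Sigma$ has the topology generated by cylinders. A word $a_1\dots a_n$ is admissible if $[a_1\dots a_n]\neq\emptyset$. $\mathcal{F}$-property: for every symbol $i\in\mathbb{N}$ and every $n\in\mathbb{N}$ there are only finitely many admissible words of length $n$ starting and ending at $i$. A periodic measure is an ergodic $\sigma$-invariant probability measure supported on a periodic orbit. $FinCyl(\Sigma)$ is the collection of non-empty finite unions of cylinders. $L(\Sigma)$ is the set of functions $F:FinCyl(\Sigma)\to[0,1]$ such that (a) $F(C)\le F(C')$ for cylinders $C\subset C'$; (b) $F(\bigcup_{k=1}^n C_k)=\sum_{k=1}^nF(C_k)$ for every finite collection of disjoint cylinders. A sequence of probability measures $(\mu_n)_n$ converges on cylinders to $F\in L(\Sigma)$ if $\lim_n\mu_n(D)=F(D)$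 for every $D\in FinCyl(\Sigma)$. $F$ extends to a measure if there is a (countably additive) Borel measure $\mu$ on $\Sigma$ with $\mu(D)=F(D)$ for all $D\in FinCyl(\Sigma)$. *)

theory Defs
  imports "HOL-Probability.Probability"
begin

(* The alphabet {1,2,...} is relabelled as the type nat = {0,1,...}, and the coordinates
   x_1, x_2, ... of a sequence are x 0, x 1, ... *)

definition markov_matrix :: "(nat \<Rightarrow> nat \<Rightarrow> nat) \<Rightarrow> bool" where
  "markov_matrix B \<longleftrightarrow>
     (\<forall>i j. B i j \<in> {0, 1}) \<and> (\<forall>i. \<exists>j. B i j \<noteq> 0) \<and> (\<forall>j. \<exists>i. B i j \<noteq> 0)"

definition markov_shift :: "(nat \<Rightarrow> nat \<Rightarrow> nat) \<Rightarrow> (nat \<Rightarrow> nat) set" where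
  "markov_shift B = {x. \<forall>n. B (x n) (x (Suc n)) = 1}"

definition shift :: "(nat \<Rightarrow> nat) \<Rightarrow> nat \<Rightarrow> nat" where
  "shift x = (\<lambda>n. x (Suc n))"

definition cylinder :: "(nat \<Rightarrow> nat \<Rightarrow> nat) \<Rightarrow> nat list \<Rightarrow> (nat \<Rightarrow> nat) set" where
  "cylinder B w = {x \<in> markov_shift B. \<forall>j < length w. x j = w ! j}"

(* Cylinders have length at least 1, so the whole shift space is not itself a cylinder. *)
definition cylinders :: "(nat \<Rightarrow> nat \<Rightarrow> nat) \<Rightarrow> (nat \<Rightarrow> nat) set set" where
  "cylinders B = {cylinder B w | w. w \<noteq> []}"

definition admissible :: "(nat \<Rightarrow> nat \<Rightarrow> nat) \<Rightarrow> nat list \<Rightarrow> bool" where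
  "admissible B w \<longleftrightarrow> cylinder B w \<noteq> {}"

definition F_property :: "(nat \<Rightarrow> nat \<Rightarrow> nat) \<Rightarrow> bool" where
  "F_property B \<longleftrightarrow>
     (\<forall>i. \<forall>n\<ge>1. finite {w. length w = n \<and> admissible B w \<and> hd w = i \<and> last w = i})"

definition shift_topology :: "(nat \<Rightarrow> nat \<Rightarrow> nat) \<Rightarrow> (nat \<Rightarrow> nat) topology" where
  "shift_topology B = topology_generated_by (cylinders B)"

(* Only the Borel sets of this measure space matter; the measure itself is a dummy. *)
definition shift_borel :: "(nat \<Rightarrow> nat \<Rightarrow> nat) \<Rightarrow> (nat \<Rightarrow> nat) measure" where
  "shift_borel B = sigma (markov_shift B) {U. openin (shift_topology B) U}"

definition borel_measure_on_shift ::
    "(nat \<Rightarrow> nat \<Rightarrow> nat) \<Rightarrow> (nat \<Rightarrow> nat) measure \<Rightarrow> bool" where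
  "borel_measure_on_shift B M \<longleftrightarrow> sets M = sets (shift_borel B)"

definition shift_invariant :: "(nat \<Rightarrow> nat) measure \<Rightarrow> bool" where
  "shift_invariant M \<longleftrightarrow> shift \<in> measurable M M \<and> distr M M shift = M"

definition shift_ergodic :: "(nat \<Rightarrow> nat) measure \<Rightarrow> bool" where
  "shift_ergodic M \<longleftrightarrow>
     (\<forall>A \<in> sets M. shift -` A \<inter> space M = A \<longrightarrow> measure M A = 0 \<or> measure M A = 1)"

definition periodic_orbit :: "(nat \<Rightarrow> nat \<Rightarrow> nat) \<Rightarrow> (nat \<Rightarrow> nat) set \<Rightarrow> bool" where
  "periodic_orbit B P \<longleftrightarrow>
     (\<exists>x \<in> markov_shift B. (\<exists>p\<ge>1. (shift ^^ p) x = x) \<and> P = {(shift ^^ k) x | k. True})"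

definition periodic_measure ::
    "(nat \<Rightarrow> nat \<Rightarrow> nat) \<Rightarrow> (nat \<Rightarrow> nat) measure \<Rightarrow> bool" where
  "periodic_measure B M \<longleftrightarrow>
     borel_measure_on_shift B M \<and> prob_space M \<and> shift_invariant M \<and> shift_ergodic M \<and>
     (\<exists>P. periodic_orbit B P \<and> P \<in> sets M \<and> measure M P = 1)"

definition FinCyl :: "(nat \<Rightarrow> nat \<Rightarrow> nat) \<Rightarrow> (nat \<Rightarrow> nat) set set" where
  "FinCyl B = {\<Union>\<C> | \<C>. finite \<C> \<and> \<C> \<subseteq> cylinders B} - {{}}"

(* The empty set is not in the domain FinCyl B, so both conditions range over non-empty
   cylinders; for these, a finite disjoint family C_1, ..., C_n with n >= 1 is the same as a
   finite non-empty disjoint set of cylinders. *)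
definition cyl_functions ::
    "(nat \<Rightarrow> nat \<Rightarrow> nat) \<Rightarrow> ((nat \<Rightarrow> nat) set \<Rightarrow> real) set" where
  "cyl_functions B =
     {F \<in> FinCyl B \<rightarrow>\<^sub>E {0..1}.
        (\<forall>C \<in> cylinders B - {{}}. \<forall>C' \<in> cylinders B - {{}}. C \<subseteq> C' \<longrightarrow> F C \<le> F C') \<and>
        (\<forall>\<C>. finite \<C> \<and> \<C> \<noteq> {} \<and> \<C> \<subseteq> cylinders B - {{}} \<and> disjoint \<C>
              \<longrightarrow> F (\<Union>\<C>) = (\<Sum>C\<in>\<C>. F C))}"

definition converges_on_cylinders ::
    "(nat \<Rightarrow> nat \<Rightarrow> nat) \<Rightarrow> (nat \<Rightarrow> (nat \<Rightarrow> nat) measure)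
       \<Rightarrow> ((nat \<Rightarrow> nat) set \<Rightarrow> real) \<Rightarrow> bool" where
  "converges_on_cylinders B \<mu> F \<longleftrightarrow>
     (\<forall>D \<in> FinCyl B. (\<lambda>n. measure (\<mu> n) D) \<longlonglongrightarrow> F D)"

definition extends_to_measure ::
    "(nat \<Rightarrow> nat \<Rightarrow> nat) \<Rightarrow> ((nat \<Rightarrow> nat) set \<Rightarrow> real) \<Rightarrow> bool" where
  "extends_to_measure B F \<longleftrightarrow>
     (\<exists>M. borel_measure_on_shift B M \<and> (\<forall>D \<in> FinCyl B. emeasure M D = ennreal (F D)))"

end

theory Submission
  imports Defs
begin

text \<open>
  If the \<open>\<F>\<close>-property fails, there are infinitely many admissible loops of one length \<open>p\<close> at one
  symbol \<open>i\<close>. Along a subsequence of the corresponding periodic points every coordinate is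
  eventually constant or leaves every finite set of symbols, so the uniform measures on the orbits
  converge on cylinders. As the loops are distinct, some coordinate (modulo \<open>p\<close>) escapes, and
  cylinders of length \<open>p\<close> see every coordinate modulo \<open>p\<close>; hence the limit vanishes on all of them,
  although it gives \<open>[i]\<close> weight at least \<open>1 / p\<close>. A countably additive extension would be zero.
\<close>

section \<open>Truth values that settle along a sequence\<close>

text \<open>Stable under finite Boolean combinations and under passing to subsequences, and strong
  enough to make indicators converge.\<close>

definition decided :: "(nat \<Rightarrow> bool) \<Rightarrow> bool" where
  "decided P \<longleftrightarrow> (\<forall>\<^sub>F k in sequentially. P k) \<or> (\<forall>\<^sub>F k in sequentially. \<not> P k)"

lemma decided_const [simp]: "decided (\<lambda>_. P)"
  by (cases P) (auto simp: decided_def)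

lemma decided_conj:
  assumes "decided P" "decided Q"
  shows "decided (\<lambda>k. P k \<and> Q k)"
  using assms eventually_mono[of "\<lambda>k. \<not> P k" sequentially "\<lambda>k. \<not> (P k \<and> Q k)"]
    eventually_mono[of "\<lambda>k. \<not> Q k" sequentially "\<lambda>k. \<not> (P k \<and> Q k)"]
  unfolding decided_def by (auto simp: eventually_conj_iff)

lemma decided_not: "decided P \<Longrightarrow> decided (\<lambda>k. \<not> P k)"
  unfolding decided_def by auto

lemma decided_ball:
  assumes "finite I" "\<And>i. i \<in> I \<Longrightarrow> decided (P i)"
  shows "decided (\<lambda>k. \<forall>i\<in>I. P i k)"
  using assms by (induction I rule: finite_induct) (auto intro: decided_conj)

lemma decided_bex:
  assumes "finite I" "\<And>i. i \<in> I \<Longrightarrow> decided (P i)"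
  shows "decided (\<lambda>k. \<exists>i\<in>I. P i k)"
  using decided_not[OF decided_ball[OF assms(1), of "\<lambda>i k. \<not> P i k"]] assms(2)
  by (auto intro: decided_not)

lemma decided_subseq:
  assumes "decided P" "strict_mono r"
  shows "decided (\<lambda>k. P (r k))"
  using assms unfolding decided_def by (auto intro: eventually_subseq)

lemma decided_convergent:
  assumes "decided P"
  shows "convergent (\<lambda>k. of_bool (P k) :: real)"
proof -
  from assms consider "\<forall>\<^sub>F k in sequentially. P k" | "\<forall>\<^sub>F k in sequentially. \<not> P k"
    unfolding decided_def by blast
  then show ?thesis
  proof cases
    case 1
    then have "(\<lambda>k. of_bool (P k) :: real) \<longlonglongrightarrow> 1"
      by (intro tendsto_eventually) (auto elim: eventually_mono)
    then show ?thesis by (rule convergentI)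
  next
    case 2
    then have "(\<lambda>k. of_bool (P k) :: real) \<longlonglongrightarrow> 0"
      by (intro tendsto_eventually) (auto elim: eventually_mono)
    then show ?thesis by (rule convergentI)
  qed
qed

text \<open>A monotone sequence that moves off \<open>c\<close> after attaining it cannot come back:
  the order would squeeze all values in between to \<open>c\<close>.\<close>

lemma monoseq_decided:
  fixes f :: "nat \<Rightarrow> 'a::linorder"
  assumes "monoseq f"
  shows "decided (\<lambda>k. f k = c)"
proof (cases "\<exists>k. f k = c")
  case False
  then show ?thesis by simp
next
  case True
  then obtain K where K: "f K = c" by blast
  show ?thesis
  proof (cases "\<exists>k\<ge>K. f k \<noteq> c")
    case False
    then show ?thesis
      unfolding decided_def eventually_sequentially by blast
  next
    case True
    then obtain L where L: "L \<ge> K" "f L \<noteq> c" by blast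
    have "f k \<noteq> c" if "k \<ge> L" for k
      using assms L K that unfolding monoseq_def
      by (metis order.antisym)
    then show ?thesis
      unfolding decided_def eventually_sequentially by blast
  qed
qed

text \<open>One monotone subsequence is extracted per coordinate. Later extractions do no harm,
  because being decided passes to subsequences.\<close>

lemma subseq_decided:
  fixes f :: "nat \<Rightarrow> nat \<Rightarrow> 'a::linorder"
  shows "\<exists>r. strict_mono r \<and> (\<forall>s<p. \<forall>c. decided (\<lambda>k. f (r k) s = c))"
proof (induction p)
  case 0
  then show ?case by (auto intro!: exI[of _ id] simp: strict_mono_id)
next
  case (Suc p)
  then obtain r where r: "strict_mono r" "\<And>s c. s < p \<Longrightarrow> decided (\<lambda>k. f (r k) s = c)"
    by blast
  obtain q where q: "strict_mono q" "monoseq (\<lambda>k. f (r (q k)) p)"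
    using seq_monosub[of "\<lambda>k. f (r k) p"] by blast
  have "decided (\<lambda>k. f (r (q k)) s = c)" if "s < Suc p" for s c
    using that monoseq_decided[OF q(2)] decided_subseq[OF r(2) q(1)]
    by (cases "s = p") auto
  moreover have "strict_mono (\<lambda>k. r (q k))"
    using strict_mono_o[OF r(1) q(1)] by (simp add: o_def)
  ultimately show ?case by blast
qed

section \<open>Cylinders, Borel sets and continuity of the shift\<close>

lemma shift_funpow: "(shift ^^ s) x = (\<lambda>n. x (s + n))"
  by (induction s) (auto simp: shift_def)

lemma shift_markov: "x \<in> markov_shift B \<Longrightarrow> shift x \<in> markov_shift B"
  by (auto simp: markov_shift_def shift_def)

lemma shift_funpow_markov: "x \<in> markov_shift B \<Longrightarrow> (shift ^^ s) x \<in> markov_shift B"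
  by (induction s) (auto intro: shift_markov)

lemma cylinder_subset: "cylinder B w \<subseteq> markov_shift B"
  by (auto simp: cylinder_def)

lemma Union_cylinders: "\<Union>(cylinders B) = markov_shift B"
proof
  show "\<Union>(cylinders B) \<subseteq> markov_shift B"
    using cylinder_subset by (auto simp: cylinders_def)
  have "x \<in> cylinder B [x 0]" if "x \<in> markov_shift B" for x
    using that by (simp add: cylinder_def)
  then show "markov_shift B \<subseteq> \<Union>(cylinders B)"
    by (fastforce simp: cylinders_def)
qed

lemma topspace_shift: "topspace (shift_topology B) = markov_shift B"
  by (simp add: shift_topology_def topology_generated_by_topspace Union_cylinders)

lemma open_subset_Pow: "{U. openin (shift_topology B) U} \<subseteq> Pow (markov_shift B)"
  using openin_subset topspace_shift by blast

lemma space_shift_borel: "space (shift_borel B) = markov_shift B"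
  by (simp add: shift_borel_def space_measure_of[OF open_subset_Pow])

lemma open_in_sets: "openin (shift_topology B) U \<Longrightarrow> U \<in> sets (shift_borel B)"
  by (simp add: shift_borel_def sets_measure_of[OF open_subset_Pow])

lemma openin_cylinder: "w \<noteq> [] \<Longrightarrow> openin (shift_topology B) (cylinder B w)"
  unfolding shift_topology_def
  by (rule topology_generated_by_Basis) (auto simp: cylinders_def)

lemma cylinder_sets: "w \<noteq> [] \<Longrightarrow> cylinder B w \<in> sets (shift_borel B)"
  by (intro open_in_sets openin_cylinder)

lemma FinCyl_sets: "D \<in> FinCyl B \<Longrightarrow> D \<in> sets (shift_borel B)"
  by (auto simp: FinCyl_def cylinders_def intro!: sets.finite_Union cylinder_sets)

lemma cylinder_FinCyl:
  assumes "w \<noteq> []" "x \<in> cylinder B w"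
  shows "cylinder B w \<in> FinCyl B"
  using assms unfolding FinCyl_def cylinders_def by (auto intro!: exI[of _ "{cylinder B w}"])

text \<open>The letter in front of \<open>w\<close> is free, so the preimage splits by it into
  cylinders. It is therefore open, which gives continuity of the shift.\<close>

lemma shift_vimage_cylinder:
  "shift -` cylinder B w \<inter> markov_shift B = (\<Union>a. cylinder B (a # w))"
proof (intro equalityI subsetI)
  fix x assume "x \<in> shift -` cylinder B w \<inter> markov_shift B"
  then have "x \<in> cylinder B (x 0 # w)"
    by (auto simp: cylinder_def shift_def nth_Cons split: nat.split)
  then show "x \<in> (\<Union>a. cylinder B (a # w))" by blast
next
  fix x assume "x \<in> (\<Union>a. cylinder B (a # w))"
  then obtain a where a: "x \<in> markov_shift B" "\<And>j. j < Suc (length w) \<Longrightarrow> x j = (a # w) ! j"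
    by (auto simp: cylinder_def)
  have "shift x j = w ! j" if "j < length w" for j
    using a(2)[of "Suc j"] that by (simp add: shift_def)
  then show "x \<in> shift -` cylinder B w \<inter> markov_shift B"
    using a(1) shift_markov by (auto simp: cylinder_def)
qed

lemma continuous_shift: "continuous_map (shift_topology B) (shift_topology B) shift"
proof -
  have "openin (shift_topology B) (shift -` U \<inter> markov_shift B)" if "U \<in> cylinders B" for U
    using that by (auto simp: cylinders_def shift_vimage_cylinder intro!: openin_cylinder)
  moreover have "shift ` markov_shift B \<subseteq> \<Union>(cylinders B)"
    using shift_markov by (auto simp: Union_cylinders)
  ultimately show ?thesis
    unfolding shift_topology_def
    using topspace_shift[of B, unfolded shift_topology_def]
    by (simp add: continuous_on_generated_topo_iff)
qed

lemma shift_measurable: "shift \<in> measurable (shift_borel B) (shift_borel B)"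
proof -
  have "shift -` U \<inter> markov_shift B \<in> sets (shift_borel B)" if "openin (shift_topology B) U" for U
  proof -
    have "shift -` U \<inter> markov_shift B = {x \<in> topspace (shift_topology B). shift x \<in> U}"
      by (auto simp: topspace_shift)
    then show ?thesis
      using openin_continuous_map_preimage[OF continuous_shift that] by (simp add: open_in_sets)
  qed
  then show ?thesis
    \<comment> \<open>Only the codomain is unfolded: measurability is then checked on open sets,
      which generate its sigma-algebra.\<close>
    by (subst (2) shift_borel_def, intro measurable_measure_of[OF open_subset_Pow])
       (auto simp: space_shift_borel shift_markov)
qed

text \<open>A point is the intersection of the cylinders around its prefixes; this later makes
  orbits Borel sets.\<close>

lemma singleton_sets:
  assumes "x \<in> markov_shift B"
  shows "{x} \<in> sets (shift_borel B)"
proof -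
  \<comment> \<open>The prefixes have length \<open>Suc n\<close> because cylinder words are
    non-empty; coordinate \<open>j\<close> is read off at \<open>n = j\<close>.\<close>
  have "{x} = (\<Inter>n. cylinder B (map x [0..<Suc n]))"
  proof (intro equalityI subsetI)
    fix y assume "y \<in> (\<Inter>n. cylinder B (map x [0..<Suc n]))"
    then have "y j = map x [0..<Suc j] ! j" for j
      unfolding cylinder_def by fastforce
    then have "y j = x j" for j by (simp del: upt_Suc)
    then show "y \<in> {x}" by auto
  qed (use assms in \<open>auto simp: cylinder_def simp del: upt_Suc\<close>)
  also have "\<dots> \<in> sets (shift_borel B)"
    by (intro sets.countable_INT) (auto intro!: cylinder_sets simp del: upt_Suc)
  finally show ?thesis .
qed

section \<open>Uniform measures on periodic orbits\<close>

text \<open>When \<open>(shift ^^ p) x = x\<close> with \<open>p > 0\<close>, this is the uniform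
  measure on the orbit of \<open>x\<close>. Any such period will do: if \<open>p\<close> is not
  minimal, every orbit point is hit equally often.\<close>

definition orbit_measure ::
    "(nat \<Rightarrow> nat \<Rightarrow> nat) \<Rightarrow> nat \<Rightarrow> (nat \<Rightarrow> nat) \<Rightarrow> (nat \<Rightarrow> nat) measure" where
  "orbit_measure B p x =
     distr (measure_pmf (pmf_of_set {..<p})) (shift_borel B) (\<lambda>s. (shift ^^ s) x)"

lemma sets_orbit_measure: "sets (orbit_measure B p x) = sets (shift_borel B)"
  by (simp add: orbit_measure_def)

lemma orbit_map_measurable:
  "x \<in> markov_shift B \<Longrightarrow>
   (\<lambda>s. (shift ^^ f s) x) \<in> measurable (measure_pmf q) (shift_borel B)"
  by (auto simp: space_shift_borel shift_funpow_markov)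

lemma prob_space_orbit_measure:
  "x \<in> markov_shift B \<Longrightarrow> prob_space (orbit_measure B p x)"
  unfolding orbit_measure_def
  by (intro prob_space.prob_space_distr prob_space_measure_pmf orbit_map_measurable[where f = "\<lambda>s. s"])

lemma measure_orbit_measure:
  assumes "x \<in> markov_shift B" "p > 0" "D \<in> sets (shift_borel B)"
  shows "measure (orbit_measure B p x) D = (\<Sum>s<p. of_bool ((shift ^^ s) x \<in> D)) / p"
proof -
  have "measure (orbit_measure B p x) D =
      measure (measure_pmf (pmf_of_set {..<p})) ((\<lambda>s. (shift ^^ s) x) -` D)"
    using measure_distr[OF orbit_map_measurable[OF assms(1), where f = "\<lambda>s. s"] assms(3)]
    by (simp add: orbit_measure_def)
  also have "\<dots> = card ({..<p} \<inter> (\<lambda>s. (shift ^^ s) x) -` D) / p"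
    using assms(2) by (subst measure_pmf_of_set) (auto simp: lessThan_empty_iff)
  also have "card ({..<p} \<inter> (\<lambda>s. (shift ^^ s) x) -` D) = (\<Sum>s<p. of_bool ((shift ^^ s) x \<in> D))"
    by (simp add: of_bool_def sum.If_cases vimage_def)
  finally show ?thesis by simp
qed

text \<open>This rotation of the times \<open>s\<close> is how the shift acts along a
  \<open>p\<close>-periodic orbit. It is injective on a finite set, hence onto.\<close>

lemma bij_betw_Suc_mod:
  assumes "p > 0"
  shows "bij_betw (\<lambda>s. Suc s mod p) {..<p} {..<p}"
proof -
  have "inj_on (\<lambda>s. Suc s mod p) {..<p}"
    by (rule inj_onI) (auto simp: mod_Suc split: if_splits)
  then show ?thesis
    using assms by (intro bij_betw_imageI endo_inj_surj) auto
qed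

text \<open>Along the orbit the shift moves time \<open>s\<close> to \<open>Suc s mod p\<close>, and
  a permutation of \<open>{..<p}\<close> preserves the uniform distribution.\<close>

lemma shift_invariant_orbit_measure:
  assumes x: "x \<in> markov_shift B" and p: "p > 0" "(shift ^^ p) x = x"
  shows "shift_invariant (orbit_measure B p x)"
proof -
  let ?U = "pmf_of_set {..<p}"
  let ?O = "\<lambda>s. (shift ^^ s) x"
  have meas: "shift \<in> measurable (orbit_measure B p x) (orbit_measure B p x)"
    using shift_measurable by (simp add: measurable_def orbit_measure_def)
  have O: "?O \<in> measurable (measure_pmf q) (shift_borel B)" for q
    using orbit_map_measurable[OF x, where f = "\<lambda>s. s"] .
  have "distr (orbit_measure B p x) (orbit_measure B p x) shift =
      distr (orbit_measure B p x) (shift_borel B) shift"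
    by (rule distr_cong) (auto simp: sets_orbit_measure)
  also have "\<dots> = distr ?U (shift_borel B) (shift \<circ> ?O)"
    unfolding orbit_measure_def by (rule distr_distr[OF shift_measurable O])
  also have "shift \<circ> ?O = ?O \<circ> (\<lambda>s. Suc s mod p)"
    using funpow_mod_eq[OF p(2)] by (auto simp: fun_eq_iff[where 'a = nat])
  also have "distr ?U (shift_borel B) \<dots> =
      distr (distr ?U (count_space UNIV) (\<lambda>s. Suc s mod p)) (shift_borel B) ?O"
    by (rule distr_distr[symmetric]) (use x in \<open>auto simp: space_shift_borel shift_funpow_markov\<close>)
  also have "distr ?U (count_space UNIV) (\<lambda>s. Suc s mod p) = map_pmf (\<lambda>s. Suc s mod p) ?U"
    by (simp add: map_pmf_rep_eq)
  also have "map_pmf (\<lambda>s. Suc s mod p) ?U = ?U"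
    using p(1) by (intro map_pmf_of_set_bij_betw bij_betw_Suc_mod) (auto simp: lessThan_empty_iff)
  finally show ?thesis
    using meas by (simp add: shift_invariant_def orbit_measure_def)
qed

lemma periodic_measure_orbit_measure:
  assumes x: "x \<in> markov_shift B" and p: "p > 0" "(shift ^^ p) x = x"
  shows "periodic_measure B (orbit_measure B p x)"
proof -
  let ?P = "{(shift ^^ k) x | k. True}"
  have "shift_ergodic (orbit_measure B p x)"
    unfolding shift_ergodic_def
  proof (intro ballI impI)
    fix A assume A: "A \<in> sets (orbit_measure B p x)"
      and inv: "shift -` A \<inter> space (orbit_measure B p x) = A"
    have inv_iff: "shift y \<in> A \<longleftrightarrow> y \<in> A" if "y \<in> markov_shift B" for y
      using inv that by (auto simp: orbit_measure_def space_shift_borel)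
    \<comment> \<open>Invariance propagates along the orbit, so the \<open>p\<close> indicators in
      the measure of \<open>A\<close> are all 0 or all 1.\<close>
    have "(shift ^^ s) x \<in> A \<longleftrightarrow> x \<in> A" for s
      by (induction s) (auto simp: inv_iff shift_funpow_markov[OF x])
    then show "measure (orbit_measure B p x) A = 0 \<or> measure (orbit_measure B p x) A = 1"
      using A p(1) by (simp add: measure_orbit_measure[OF x] sets_orbit_measure)
  qed
  moreover have "periodic_orbit B ?P"
    using x p unfolding periodic_orbit_def by (intro bexI[of _ x] conjI exI[of _ p]) auto
  moreover have P: "?P \<in> sets (shift_borel B)"
  proof -
    have "?P = (\<Union>k. {(shift ^^ k) x})" by auto
    also have "\<dots> \<in> sets (shift_borel B)"
      by (intro sets.countable_UN'') (auto intro: singleton_sets shift_funpow_markov[OF x])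
    finally show ?thesis .
  qed
  moreover have "measure (orbit_measure B p x) ?P = 1"
  proof -
    have "of_bool ((shift ^^ s) x \<in> ?P) = (1::real)" for s by auto
    then show ?thesis
      unfolding measure_orbit_measure[OF x p(1) P] using p(1) by simp
  qed
  ultimately show ?thesis
    unfolding periodic_measure_def borel_measure_on_shift_def
    using prob_space_orbit_measure[OF x] shift_invariant_orbit_measure[OF assms]
    by (auto simp: sets_orbit_measure)
qed

section \<open>Limits of probability measures on cylinders\<close>

text \<open>Bounds, monotonicity and finite additivity are equations or weak inequalities between
  finitely many values, so they survive pointwise limits; countable additivity need not.\<close>

lemma limit_in_cyl_functions:
  assumes prob: "\<And>k. prob_space (\<mu> k)"
    and sets: "\<And>k. sets (\<mu> k) = sets (shift_borel B)"
    and conv: "converges_on_cylinders B \<mu> F"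
    and ext: "F \<in> extensional (FinCyl B)"
  shows "F \<in> cyl_functions B"
proof -
  have lim: "(\<lambda>k. measure (\<mu> k) D) \<longlonglongrightarrow> F D" if "D \<in> FinCyl B" for D
    using conv that by (simp add: converges_on_cylinders_def)
  have cyl: "C \<in> FinCyl B" if "C \<in> cylinders B - {{}}" for C
    using that by (auto simp: cylinders_def intro: cylinder_FinCyl)
  have bounds: "F D \<in> {0..1}" if "D \<in> FinCyl B" for D
    using LIMSEQ_le_const[OF lim[OF that]] LIMSEQ_le_const2[OF lim[OF that]]
      prob_space.prob_le_1[OF prob] by auto
  have mono: "F C \<le> F C'"
    if "C \<in> cylinders B - {{}}" "C' \<in> cylinders B - {{}}" "C \<subseteq> C'" for C C'
  proof (rule LIMSEQ_le[OF lim lim])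
    have "measure (\<mu> k) C \<le> measure (\<mu> k) C'" for k
    proof -
      interpret prob_space "\<mu> k" by (rule prob)
      show ?thesis
        using that by (intro finite_measure_mono) (auto simp: sets FinCyl_sets cyl)
    qed
    then show "\<exists>N. \<forall>k\<ge>N. measure (\<mu> k) C \<le> measure (\<mu> k) C'" by blast
  qed (use that cyl in auto)
  have add: "F (\<Union>\<C>) = (\<Sum>C\<in>\<C>. F C)"
    if \<C>: "finite \<C>" "\<C> \<noteq> {}" "\<C> \<subseteq> cylinders B - {{}}" "disjoint \<C>" for \<C>
  proof (rule LIMSEQ_unique)
    have "\<Union>\<C> \<in> FinCyl B"
      using \<C> unfolding FinCyl_def by blast
    then show "(\<lambda>k. measure (\<mu> k) (\<Union>\<C>)) \<longlonglongrightarrow> F (\<Union>\<C>)" by (rule lim)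
    have "measure (\<mu> k) (\<Union>\<C>) = (\<Sum>C\<in>\<C>. measure (\<mu> k) C)" for k
    proof -
      interpret prob_space "\<mu> k" by (rule prob)
      show ?thesis
        using \<C> finite_measure_finite_Union[of \<C> "\<lambda>C. C"]
        by (auto simp: sets disjoint_family_on_def disjoint_def intro!: FinCyl_sets cyl)
    qed
    moreover have "(\<lambda>k. \<Sum>C\<in>\<C>. measure (\<mu> k) C) \<longlonglongrightarrow> (\<Sum>C\<in>\<C>. F C)"
      using \<C> by (intro tendsto_sum lim cyl) auto
    ultimately show "(\<lambda>k. measure (\<mu> k) (\<Union>\<C>)) \<longlonglongrightarrow> (\<Sum>C\<in>\<C>. F C)" by simp
  qed
  show ?thesis
    unfolding cyl_functions_def using bounds mono add ext by (auto simp: PiE_def)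
qed

section \<open>Periodic points from infinitely many loops\<close>

text \<open>Repeating a loop at \<open>i\<close> without its final letter gives a periodic point,
  and different loops of equal length give different points.\<close>

lemma not_F_property_loops:
  assumes "\<not> F_property B"
  obtains i p and y :: "nat \<Rightarrow> nat \<Rightarrow> nat" where
    "p > 0" "inj y" "\<And>k. y k \<in> markov_shift B" "\<And>k. (shift ^^ p) (y k) = y k" "\<And>k. y k 0 = i"
proof -
  from assms obtain i n where n: "n \<ge> 1"
    and inf: "infinite {w. length w = n \<and> admissible B w \<and> hd w = i \<and> last w = i}" (is "infinite ?W")
    unfolding F_property_def by blast
  \<comment> \<open>The only one-letter loop at \<open>i\<close> is \<open>[i]\<close>, so an
    infinite family has \<open>n > 1\<close> and the period \<open>n - 1\<close> is
    positive.\<close>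
  have "n \<noteq> 1"
  proof
    assume "n = 1"
    then have "?W \<subseteq> {[i]}" by (auto simp: length_Suc_conv)
    then show False using inf finite_subset by blast
  qed
  \<comment> \<open>The final letter of a loop doubles as the first letter of the next
    round.\<close>
  define p where "p = n - 1"
  have p: "p > 0" "n = Suc p" using n \<open>n \<noteq> 1\<close> by (auto simp: p_def)
  obtain w :: "nat \<Rightarrow> nat list" where w: "inj w" "range w \<subseteq> ?W"
    using infinite_countable_subset[OF inf] by blast
  have len: "length (w k) = Suc p" and adm: "admissible B (w k)" for k
    using w(2) p(2) by auto
  have "w k \<noteq> []" for k
    using len[of k] by auto
  then have first: "w k ! 0 = i" and last: "w k ! p = i" for k
    using w(2) len[of k] hd_conv_nth[of "w k"] last_conv_nth[of "w k"]
    by (auto simp: image_subset_iff)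
  define y where "y = (\<lambda>k m. w k ! (m mod p))"
  \<comment> \<open>An admissible word is the prefix of a point of the shift, so its transitions are
    allowed.\<close>
  have step: "B (w k ! j) (w k ! Suc j) = 1" if "j < p" for k j
  proof -
    obtain x where x: "x \<in> cylinder B (w k)"
      using adm[of k] by (auto simp: admissible_def)
    then have "B (x j) (x (Suc j)) = 1"
      by (auto simp: cylinder_def markov_shift_def)
    moreover have "x j = w k ! j" "x (Suc j) = w k ! Suc j"
      using x that len[of k] by (auto simp: cylinder_def)
    ultimately show ?thesis by simp
  qed
  \<comment> \<open>At the wrap-around \<open>m mod p = p - 1\<close> the next letter is
    \<open>w k ! 0\<close>, which agrees with \<open>w k ! p\<close> since both are
    \<open>i\<close>.\<close>
  have Suc_y: "y k (Suc m) = w k ! Suc (m mod p)" for k m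
    using first last by (simp add: y_def mod_Suc)
  show thesis
  proof (rule that[of p y i])
    show "inj y"
    proof (rule injI)
      fix k l assume eq: "y k = y l"
      \<comment> \<open>\<open>y k\<close> shows the first \<open>p\<close> letters of
        \<open>w k\<close>; the remaining one is always \<open>i\<close>.\<close>
      have "w k ! j = w l ! j" if "j < Suc p" for j
      proof (cases "j < p")
        case True
        then show ?thesis using fun_cong[OF eq, of j] by (simp add: y_def)
      next
        case False
        then have "j = p" using that by simp
        then show ?thesis by (simp add: last)
      qed
      then have "w k = w l" by (intro nth_equalityI) (auto simp: len)
      then show "k = l" using w(1) by (auto dest: injD)
    qed
    show "y k \<in> markov_shift B" for k
      unfolding markov_shift_def using step p(1) by (auto simp: Suc_y) (simp add: y_def)
  qed (use p(1) first in \<open>auto simp: shift_funpow y_def\<close>)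
qed

section \<open>The obstruction to countable additivity\<close>

text \<open>The words of length \<open>p\<close> are countably many and their cylinders cover the
  shift space. If all of them are null, countable additivity makes every Borel set null, against
  \<open>F D > 0\<close>.\<close>

lemma not_extends_if_null_cylinders:
  assumes p: "p > 0"
    and null: "\<And>w. length w = p \<Longrightarrow> cylinder B w \<noteq> {} \<Longrightarrow> F (cylinder B w) = 0"
    and D: "D \<in> FinCyl B" "F D > 0"
  shows "\<not> extends_to_measure B F"
proof
  assume "extends_to_measure B F"
  then obtain M where sets: "sets M = sets (shift_borel B)"
    and M: "\<And>D. D \<in> FinCyl B \<Longrightarrow> emeasure M D = ennreal (F D)"
    unfolding extends_to_measure_def borel_measure_on_shift_def by blast
  have "cylinder B w \<in> null_sets M" if w: "length w = p" for w
  proof -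
    have "w \<noteq> []" using w p by auto
    moreover have "emeasure M (cylinder B w) = 0"
    \<comment> \<open>The empty set lies outside \<open>FinCyl B\<close>, where \<open>M\<close> is
      not tied to \<open>F\<close>, so it is treated apart.\<close>
    proof (cases "cylinder B w = {}")
      case False
      then have "cylinder B w \<in> FinCyl B"
        using \<open>w \<noteq> []\<close> by (auto intro: cylinder_FinCyl)
      then show ?thesis using M null[OF w False] by simp
    qed simp
    ultimately show ?thesis by (auto simp: null_sets_def sets cylinder_sets)
  qed
  then have "(\<Union>w\<in>{w. length w = p}. cylinder B w) \<in> null_sets M"
    by (intro null_sets_UN') auto
  moreover have "x \<in> (\<Union>w\<in>{w. length w = p}. cylinder B w)" if "x \<in> markov_shift B" for x
    using that by (auto simp: cylinder_def intro!: exI[of _ "map x [0..<p]"])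
  then have "D \<subseteq> (\<Union>w\<in>{w. length w = p}. cylinder B w)"
    using sets.sets_into_space[OF FinCyl_sets[OF D(1)]] by (auto simp: space_shift_borel)
  ultimately have "emeasure M D = 0"
    using FinCyl_sets[OF D(1)] sets by (metis null_sets_subset null_setsD1)
  then show False using M[OF D(1)] D(2) by (simp add: ennreal_eq_0_iff)
qed

section \<open>The sequence of periodic measures and its limit\<close>

theorem proposition4p19:
  fixes B :: "nat \<Rightarrow> nat \<Rightarrow> nat"
  assumes "markov_matrix B"
    and "\<not> F_property B"
  shows "\<exists>(\<mu> :: nat \<Rightarrow> (nat \<Rightarrow> nat) measure) F.
           (\<forall>n. periodic_measure B (\<mu> n)) \<and>
           F \<in> cyl_functions B \<and>
           converges_on_cylinders B \<mu> F \<and>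
           \<not> extends_to_measure B F"
proof -
  obtain i p and y :: "nat \<Rightarrow> nat \<Rightarrow> nat" where p: "p > 0" and y: "inj y"
    "\<And>k. y k \<in> markov_shift B" "\<And>k. (shift ^^ p) (y k) = y k" "\<And>k. y k 0 = i"
    using not_F_property_loops[OF assms(2)] by metis
  obtain r where r: "strict_mono r" "\<And>s c. s < p \<Longrightarrow> decided (\<lambda>k. y (r k) s = c)"
    using subseq_decided[of p y] by blast
  define z where "z = (\<lambda>k. y (r k))"
  have z: "\<And>k. z k \<in> markov_shift B" and per: "\<And>k. (shift ^^ p) (z k) = z k"
    and z0: "\<And>k. z k 0 = i" and inj: "inj z" and dec0: "\<And>s c. s < p \<Longrightarrow> decided (\<lambda>k. z k s = c)"
    using y r(2) inj_compose[OF y(1) strict_mono_imp_inj_on[OF r(1)]]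
    by (simp_all add: z_def o_def)
  \<comment> \<open>By periodicity, what is known of the first \<open>p\<close> coordinates governs
    all of them.\<close>
  have zmod: "z k (m mod p) = z k m" for k m
    using funpow_mod_eq[OF per, of m k] by (metis add_0_right shift_funpow)
  have dec: "decided (\<lambda>k. z k m = c)" for m c
    using dec0[of "m mod p" c] p by (simp add: zmod)
  define \<mu> where "\<mu> = (\<lambda>k. orbit_measure B p (z k))"
  have measure_\<mu>: "measure (\<mu> k) D = (\<Sum>s<p. of_bool ((shift ^^ s) (z k) \<in> D)) / p"
    if "D \<in> FinCyl B" for k D
    unfolding \<mu>_def using measure_orbit_measure[OF z p FinCyl_sets[OF that]] .
  have dec_cyl: "decided (\<lambda>k. (shift ^^ s) (z k) \<in> cylinder B w)" for s w
  proof -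
    have "decided (\<lambda>k. \<forall>j\<in>{..<length w}. z k (s + j) = w ! j)"
      by (intro decided_ball dec) auto
    then show ?thesis
      using shift_funpow_markov[OF z, of s]
      by (simp add: cylinder_def shift_funpow Ball_def)
  qed
  \<comment> \<open>The restriction to \<open>FinCyl B\<close> makes \<open>F\<close> extensional,
    as \<open>cyl_functions\<close> demands; \<open>lim\<close> becomes a true limit once
    convergence is shown.\<close>
  define F where "F = (\<lambda>D\<in>FinCyl B. lim (\<lambda>k. measure (\<mu> k) D))"
  have conv: "converges_on_cylinders B \<mu> F"
    unfolding converges_on_cylinders_def
  proof
    fix D assume D: "D \<in> FinCyl B"
    then obtain \<C> where \<C>: "D = \<Union>\<C>" "finite \<C>" "\<C> \<subseteq> cylinders B"
      by (auto simp: FinCyl_def)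
    \<comment> \<open>Membership in \<open>D\<close> is a finite disjunction of cylinder
      memberships, each a finite conjunction of decided coordinate conditions.\<close>
    have "decided (\<lambda>k. \<exists>C\<in>\<C>. (shift ^^ s) (z k) \<in> C)" for s
      using \<C>(2,3) dec_cyl by (intro decided_bex) (auto simp: cylinders_def)
    then have "convergent (\<lambda>k. of_bool ((shift ^^ s) (z k) \<in> D) :: real)" for s
      using decided_convergent by (simp add: \<C>(1))
    then have "convergent (\<lambda>k. measure (\<mu> k) D)"
      unfolding measure_\<mu>[OF D] divide_inverse
      by (intro convergent_mult convergent_sum convergent_const)
    then show "(\<lambda>k. measure (\<mu> k) D) \<longlonglongrightarrow> F D"
      using D by (simp add: F_def convergent_LIMSEQ_iff)
  qed
  have per_\<mu>: "periodic_measure B (\<mu> k)" for k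
    unfolding \<mu>_def by (rule periodic_measure_orbit_measure[OF z p per])
  then have F: "F \<in> cyl_functions B"
    by (intro limit_in_cyl_functions[OF _ _ conv])
       (auto simp: periodic_measure_def borel_measure_on_shift_def F_def)
  \<comment> \<open>If all \<open>p\<close> coordinates stabilised, \<open>z\<close> would be
    eventually constant, which injectivity forbids.\<close>
  obtain t where t: "t < p" "\<And>c. \<not> (\<forall>\<^sub>F k in sequentially. z k t = c)"
  proof (rule ccontr)
    assume "\<not> thesis"
    then have "\<forall>t<p. \<exists>c. \<forall>\<^sub>F k in sequentially. z k t = c" using that by blast
    then obtain c where "\<And>t. t < p \<Longrightarrow> \<forall>\<^sub>F k in sequentially. z k t = c t" by metis
    then have "\<forall>\<^sub>F k in sequentially. \<forall>t\<in>{..<p}. z k t = c t"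
      by (intro eventually_ball_finite) auto
    then obtain K where K: "\<And>k t. k \<ge> K \<Longrightarrow> t < p \<Longrightarrow> z k t = c t"
      unfolding eventually_sequentially by blast
    have "z K m = z (Suc K) m" for m
      using K[of K "m mod p"] K[of "Suc K" "m mod p"] p zmod by simp
    then have "z K = z (Suc K)" by blast
    then show False using inj by (auto dest: injD)
  qed
  have escape: "\<forall>\<^sub>F k in sequentially. z k t \<noteq> c" for c
    using dec[of t c] t(2)[of c] by (simp add: decided_def)
  have null: "F (cylinder B w) = 0" if w: "length w = p" and ne: "cylinder B w \<noteq> {}" for w
  proof -
    have D: "cylinder B w \<in> FinCyl B"
      using w p ne by (auto intro: cylinder_FinCyl)
    \<comment> \<open>\<open>w\<close> has finitely many letters, so one bound on \<open>k\<close>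
      serves all of them.\<close>
    have avoid: "\<forall>\<^sub>F k in sequentially. \<forall>c\<in>set w. z k t \<noteq> c"
      by (intro eventually_ball_finite) (auto intro: escape)
    have "measure (\<mu> k) (cylinder B w) = 0" if k: "\<forall>c\<in>set w. z k t \<noteq> c" for k
    proof -
      have "(shift ^^ s) (z k) \<notin> cylinder B w" if s: "s < p" for s
      proof
        assume *: "(shift ^^ s) (z k) \<in> cylinder B w"
        \<comment> \<open>This solves \<open>s + j = t\<close> modulo \<open>p\<close>; writing
          \<open>p - s\<close> avoids a truncated subtraction. As \<open>j < p = length w\<close>,
          the cylinder prescribes a letter at position \<open>j\<close> of the shifted point, which
          is \<open>z k t\<close>.\<close>
        define j where "j = (t + (p - s)) mod p"
        have "j < p" using p by (simp add: j_def)
        moreover have "(s + j) mod p = t"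
          using s t(1) by (simp add: j_def mod_add_right_eq)
        ultimately have "z k t = w ! j"
          using * w zmod[of k "s + j"] by (simp add: cylinder_def shift_funpow)
        then show False using k \<open>j < p\<close> w by simp
      qed
      then show ?thesis by (simp add: measure_\<mu>[OF D])
    qed
    then have "(\<lambda>k. measure (\<mu> k) (cylinder B w)) \<longlonglongrightarrow> 0"
      by (intro tendsto_eventually eventually_mono[OF avoid])
    moreover have "(\<lambda>k. measure (\<mu> k) (cylinder B w)) \<longlonglongrightarrow> F (cylinder B w)"
      using conv D by (simp add: converges_on_cylinders_def)
    ultimately show ?thesis by (rule LIMSEQ_unique[symmetric])
  qed
  have zi: "z k \<in> cylinder B [i]" for k
    using z z0 by (simp add: cylinder_def)
  then have Di: "cylinder B [i] \<in> FinCyl B"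
    by (intro cylinder_FinCyl) auto
  \<comment> \<open>Time \<open>s = 0\<close> always contributes, since \<open>z k\<close> starts
    with \<open>i\<close>; so every measure in the sequence gives \<open>[i]\<close> at least
    \<open>1 / p\<close>.\<close>
  have "1 / p \<le> F (cylinder B [i])"
  proof (rule LIMSEQ_le_const)
    show "(\<lambda>k. measure (\<mu> k) (cylinder B [i])) \<longlonglongrightarrow> F (cylinder B [i])"
      using conv Di by (simp add: converges_on_cylinders_def)
    have "(1::real) \<le> (\<Sum>s<p. of_bool ((shift ^^ s) (z k) \<in> cylinder B [i]))" for k
      using member_le_sum[of 0 "{..<p}"
          "\<lambda>s. of_bool ((shift ^^ s) (z k) \<in> cylinder B [i]) :: real"] p zi by auto
    then show "\<exists>N. \<forall>k\<ge>N. 1 / p \<le> measure (\<mu> k) (cylinder B [i])"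
      by (auto simp: measure_\<mu>[OF Di] intro!: divide_right_mono)
  qed
  then have "F (cylinder B [i]) > 0"
    using p by (auto intro: less_le_trans[of _ "1 / p"])
  then have "\<not> extends_to_measure B F"
    by (intro not_extends_if_null_cylinders[OF p _ Di] null)
  then show ?thesis using per_\<mu> F conv by blast
qed

end
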